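(* Let $n\ge2$. For every limit ordinal $\alpha\ge\omega$, the relation $H(x,y)$, which holds iff $\operatorname{ht}(x)=\operatorname{ht}(y)$, is not definable by a first-order formula in the structure $\mathfrak T_\alpha^n$; that is, there is no first-order formula $\varphi(x,y)$ in the language $\{\subseteq,S_0,\dots,S_{n-1}\}$ such that for all nodes $x,y$, $\mathfrak T_\alpha^n\models\varphi(x,y)$ iff $\operatorname{ht}(x)=\operatorname{ht}(y)$.
   Context: $\mathfrak T_\alpha^n=(n^{<\alpha},\subseteq,S_0,\dots,S_{n-1})$, where $n^{<\alpha}$ is the set of all functions $s:\beta\to n=\{0,\dots,n-1\}$ with $\beta<\alpha$, $\subseteq$ is the initial-segment (inclusion) order, and $S_i(s)$ is $s$ extended by one further entry $i$. The height $\operatorname{ht}(s)$ is the domain $\beta$ of $s$. *)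

theory Defs
  imports Main
begin

unbundle cardinal_syntax

section \<open>First-order logic with equality in the language \<open>{\<subseteq>, S\<^sub>0, \<dots>, S\<^sub>n\<^sub>-\<^sub>1}\<close>\<close>

datatype trm = Var nat | Succ nat trm

datatype fm =
    Eq trm trm
  | Le trm trm
  | Neg fm
  | Conj fm fm
  | Ex nat fm

text \<open>The syntax has a function symbol \<open>S\<^sub>i\<close> for every natural number \<open>i\<close>; the predicates
  \<open>trm_in_lang n\<close> and \<open>fm_in_lang n\<close> single out the language with \<open>S\<^sub>0, \<dots>, S\<^sub>n\<^sub>-\<^sub>1\<close> only.\<close>

primrec trm_in_lang :: "nat \<Rightarrow> trm \<Rightarrow> bool" where
  "trm_in_lang n (Var v) \<longleftrightarrow> True"
| "trm_in_lang n (Succ i t) \<longleftrightarrow> i < n \<and> trm_in_lang n t"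

primrec fm_in_lang :: "nat \<Rightarrow> fm \<Rightarrow> bool" where
  "fm_in_lang n (Eq s t) \<longleftrightarrow> trm_in_lang n s \<and> trm_in_lang n t"
| "fm_in_lang n (Le s t) \<longleftrightarrow> trm_in_lang n s \<and> trm_in_lang n t"
| "fm_in_lang n (Neg p) \<longleftrightarrow> fm_in_lang n p"
| "fm_in_lang n (Conj p q) \<longleftrightarrow> fm_in_lang n p \<and> fm_in_lang n q"
| "fm_in_lang n (Ex v p) \<longleftrightarrow> fm_in_lang n p"

primrec trm_vars :: "trm \<Rightarrow> nat set" where
  "trm_vars (Var v) = {v}"
| "trm_vars (Succ i t) = trm_vars t"

primrec free_vars :: "fm \<Rightarrow> nat set" where
  "free_vars (Eq s t) = trm_vars s \<union> trm_vars t"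
| "free_vars (Le s t) = trm_vars s \<union> trm_vars t"
| "free_vars (Neg p) = free_vars p"
| "free_vars (Conj p q) = free_vars p \<union> free_vars q"
| "free_vars (Ex v p) = free_vars p - {v}"

record 'u fo_structure =
  univ :: "'u set"
  le :: "'u \<Rightarrow> 'u \<Rightarrow> bool"
  succs :: "nat \<Rightarrow> 'u \<Rightarrow> 'u"

primrec trm_val :: "'u fo_structure \<Rightarrow> (nat \<Rightarrow> 'u) \<Rightarrow> trm \<Rightarrow> 'u" where
  "trm_val M e (Var v) = e v"
| "trm_val M e (Succ i t) = succs M i (trm_val M e t)"

primrec sat :: "'u fo_structure \<Rightarrow> (nat \<Rightarrow> 'u) \<Rightarrow> fm \<Rightarrow> bool" where
  "sat M e (Eq s t) \<longleftrightarrow> trm_val M e s = trm_val M e t"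
| "sat M e (Le s t) \<longleftrightarrow> le M (trm_val M e s) (trm_val M e t)"
| "sat M e (Neg p) \<longleftrightarrow> \<not> sat M e p"
| "sat M e (Conj p q) \<longleftrightarrow> sat M e p \<and> sat M e q"
| "sat M e (Ex v p) \<longleftrightarrow> (\<exists>a \<in> univ M. sat M (e(v := a)) p)"

text \<open>A formula \<open>\<phi>(x, y)\<close> is one whose free variables are among the variables 0 (for \<open>x\<close>)
  and 1 (for \<open>y\<close>); the values of the assignment at other variables are irrelevant.\<close>

definition definable2 :: "nat \<Rightarrow> 'u fo_structure \<Rightarrow> ('u \<Rightarrow> 'u \<Rightarrow> bool) \<Rightarrow> bool" where
  "definable2 n M R \<longleftrightarrow>
     (\<exists>p. fm_in_lang n p \<and> free_vars p \<subseteq> {0, 1} \<and>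
        (\<forall>x \<in> univ M. \<forall>y \<in> univ M. sat M (\<lambda>v. if v = 0 then x else y) p \<longleftrightarrow> R x y))"


section \<open>The tree of words of length less than an ordinal\<close>

text \<open>An ordinal \<open>\<alpha>\<close> is given as a well-order \<open>r\<close>. The ordinals \<open>\<beta> < \<alpha>\<close> are the elements \<open>b\<close> of
  \<open>Field r\<close>, where \<open>b\<close> stands for the order type of \<open>underS r b\<close>. A function \<open>\<beta> \<rightarrow> n\<close> is a
  partial function with domain \<open>underS r b\<close> and values below \<open>n\<close>; inclusion of functions
  (as graphs) is \<open>map_le\<close>.\<close>

definition limit_ord :: "'a rel \<Rightarrow> bool" where
  "limit_ord r \<longleftrightarrow> Well_order r \<and> Field r \<noteq> {} \<and>
     \<not> (\<exists>j \<in> Field r. \<forall>i \<in> Field r. (i, j) \<in> r)"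

definition nodes :: "nat \<Rightarrow> 'a rel \<Rightarrow> ('a \<rightharpoonup> nat) set" where
  "nodes n r = {s. (\<exists>b \<in> Field r. dom s = underS r b) \<and> ran s \<subseteq> {..<n}}"

definition ht :: "'a rel \<Rightarrow> ('a \<rightharpoonup> nat) \<Rightarrow> 'a" where
  "ht r s = (THE b. b \<in> Field r \<and> dom s = underS r b)"

text \<open>As \<open>\<beta> + 1 = \<beta> \<union> {\<beta>}\<close>, extending \<open>s : \<beta> \<rightarrow> n\<close> by one entry \<open>i\<close> adds the value \<open>i\<close> at \<open>\<beta>\<close>.\<close>

definition extend :: "'a rel \<Rightarrow> nat \<Rightarrow> ('a \<rightharpoonup> nat) \<Rightarrow> ('a \<rightharpoonup> nat)" where
  "extend r i s = s(ht r s \<mapsto> i)"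

definition tree :: "nat \<Rightarrow> 'a rel \<Rightarrow> ('a \<rightharpoonup> nat) fo_structure" where
  "tree n r = \<lparr>univ = nodes n r, le = (\<subseteq>\<^sub>m), succs = extend r\<rparr>"

lemma underS_inj:
  assumes "Well_order r" "a \<in> Field r" "b \<in> Field r" "underS r a = underS r b"
  shows "a = b"
proof (rule ccontr)
  assume ne: "a \<noteq> b"
  have "(a, b) \<in> r \<or> (b, a) \<in> r"
    using assms(1-3) ne unfolding well_order_on_def linear_order_on_def total_on_def by blast
  with ne have "a \<in> underS r b \<or> b \<in> underS r a" by (auto simp: underS_def)
  with assms(4) show False by (auto simp: underS_def)
qed

lemma ht_eqI:
  assumes "Well_order r" "b \<in> Field r" "dom s = underS r b"
  shows "ht r s = b"
  unfolding ht_def using assms by (intro the_equality) (auto dest: underS_inj)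

lemma extend_in_nodes:
  assumes "limit_ord r" "s \<in> nodes n r" "i < n"
  shows "extend r i s \<in> nodes n r"
proof -
  have wo: "Well_order r" using assms(1) by (simp add: limit_ord_def)
  interpret wo_rel r using wo by (simp add: wo_rel_def)
  obtain b where b: "b \<in> Field r" "dom s = underS b" "ran s \<subseteq> {..<n}"
    using assms(2) by (auto simp: nodes_def)
  have h: "ht r s = b" using ht_eqI[OF wo b(1,2)] .
  have "aboveS b \<noteq> {}"
  proof -
    obtain c where "c \<in> Field r" "(c, b) \<notin> r"
      using assms(1) b(1) by (auto simp: limit_ord_def)
    with b(1) have "(b, c) \<in> r" "c \<noteq> b" using TOTALS REFL by (auto simp: refl_on_def)
    thus ?thesis by (auto simp: aboveS_def)
  qed
  then have AS: "AboveS {b} \<noteq> {}" using b(1) by (auto simp: AboveS_def aboveS_def Field_def)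
  define c where "c = suc {b}"
  have c: "c \<in> Field r" "(b, c) \<in> r" "b \<noteq> c"
    unfolding c_def using suc_inField[of "{b}"] suc_greater[of "{b}" b] b(1) AS by auto
  have least: "(c, d) \<in> r" if "d \<in> Field r" "(b, d) \<in> r" "d \<noteq> b" for d
    unfolding c_def using suc_least_AboveS[of d "{b}"] that by (auto simp: AboveS_def)
  have "underS c = insert b (underS b)"
  proof
    show "insert b (underS b) \<subseteq> underS c"
      using c(2,3) TRANS ANTISYM unfolding underS_def trans_def antisym_def by blast
    show "underS c \<subseteq> insert b (underS b)"
    proof
      fix d assume "d \<in> underS c"
      then have d: "d \<noteq> c" "(d, c) \<in> r" by (auto simp: underS_def)
      then have dF: "d \<in> Field r" by (auto simp: Field_def)
      show "d \<in> insert b (underS b)"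
      proof (rule ccontr)
        assume "d \<notin> insert b (underS b)"
        then have "d \<noteq> b" "(d, b) \<notin> r" by (auto simp: underS_def)
        then have "(b, d) \<in> r" using TOTALS dF b(1) by auto
        with least dF \<open>d \<noteq> b\<close> have "(c, d) \<in> r" by auto
        with d ANTISYM show False by (auto simp: antisym_def)
      qed
    qed
  qed
  then have "dom (extend r i s) = underS c" using b(2) h by (simp add: extend_def)
  moreover have "ran (extend r i s) \<subseteq> {..<n}"
    using b(3) assms(3) by (auto simp: extend_def ran_def split: if_splits)
  ultimately show ?thesis using c(1) by (auto simp: nodes_def)
qed

end

theory Submission
  imports Defs
begin

text \<open>Let \<open>W\<close> prefix a word with the letter 1, that is, \<open>W s = 1\<^sup>\<frown>s\<close>; it maps the tree isomorphically
  onto the cone above the word 1, because \<open>1 + \<beta> < \<alpha>\<close> for all \<open>\<beta> < \<alpha>\<close>. Relative to a marked node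
  \<open>1\<^sup>m\<close> with finite \<open>m\<close>, every word is uniquely \<open>1\<^sup>j\<^sup>\<frown>t\<close> with \<open>j \<le> m\<close>, where \<open>t\<close> does not begin with 1
  unless \<open>j = m\<close>. In the Ehrenfeucht--Fraisse game comparing the marked nodes \<open>1\<^sup>m\<close> and \<open>1\<^sup>m\<^sup>'\<close>,
  Duplicator keeps the remainders \<open>t\<close> fixed and plays the game of the finite linear orders
  \<open>{0..m}\<close>, \<open>{0..m'}\<close> on the exponents \<open>j\<close>. If \<open>m\<close> and \<open>m'\<close> are large, she survives any given
  number of rounds. As \<open>0\<^sup>m\<close> corresponds to itself, the pairs \<open>(0\<^sup>m, 1\<^sup>m)\<close> and \<open>(0\<^sup>m, 1\<^sup>m\<^sup>+\<^sup>1)\<close> satisfy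
  the same formulas of small rank, but only the first pair has equal heights.\<close>

section \<open>The game on the exponents\<close>

text \<open>The invariant of the Ehrenfeucht--Fraisse game on finite linear orders: two signed gaps
  count as alike if they are equal, or have the same sign and both reach the threshold K. Integers
  avoid truncated subtraction.\<close>

definition similar_gap :: "nat \<Rightarrow> nat \<times> nat \<Rightarrow> nat \<times> nat \<Rightarrow> bool" where
  "similar_gap K p q \<longleftrightarrow>
     int (fst p) - int (fst q) = int (snd p) - int (snd q)
     \<or> fst p + K \<le> fst q \<and> snd p + K \<le> snd q
     \<or> fst q + K \<le> fst p \<and> snd q + K \<le> snd p"

text \<open>The endpoints count as already played. With k moves left the threshold is 2^k, so each
  move may halve it.\<close>

definition coherent :: "nat \<Rightarrow> nat \<Rightarrow> nat \<Rightarrow> (nat \<times> nat) set \<Rightarrow> bool" where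
  "coherent k m m' P \<longleftrightarrow> (0, 0) \<in> P \<and> (m, m') \<in> P \<and> (\<forall>p \<in> P. \<forall>q \<in> P. similar_gap (2 ^ k) p q)"

lemma similar_gap_refl: "similar_gap K p p"
  by (simp add: similar_gap_def)

lemma similar_gap_sym: "similar_gap K p q \<Longrightarrow> similar_gap K q p"
  by (auto simp: similar_gap_def)

lemma similar_gap_mono: "similar_gap K p q \<Longrightarrow> L \<le> K \<Longrightarrow> similar_gap L p q"
  by (auto simp: similar_gap_def)

lemma coherent_gap:
  "coherent k m m' P \<Longrightarrow> (i, i') \<in> P \<Longrightarrow> (j, j') \<in> P \<Longrightarrow> similar_gap (2 ^ k) (i, i') (j, j')"
  by (auto simp: coherent_def)

text \<open>As 2^k >= 1, every alternative in \<open>similar_gap\<close> fixes the sign of the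
  gap.\<close>

lemma coherent_less_iff:
  assumes "coherent k m m' P" "(i, i') \<in> P" "(j, j') \<in> P"
  shows "i < j \<longleftrightarrow> i' < j'"
proof -
  have "(1::nat) \<le> 2 ^ k" by simp
  then show ?thesis using coherent_gap[OF assms] unfolding similar_gap_def fst_conv snd_conv
    by linarith
qed

lemma coherent_eq_iff:
  assumes "coherent k m m' P" "(i, i') \<in> P" "(j, j') \<in> P"
  shows "i = j \<longleftrightarrow> i' = j'"
  using coherent_less_iff[OF assms] coherent_less_iff[OF assms(1,3,2)] by linarith

lemma coherent_converse: "coherent k m m' P \<Longrightarrow> coherent k m' m (P\<inverse>)"
  by (fastforce simp: coherent_def similar_gap_def)

lemma coherent_insert:
  assumes "coherent (Suc k) m m' P" "\<And>p. p \<in> P \<Longrightarrow> similar_gap (2 ^ k) (j, j') p"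
  shows "coherent k m m' (insert (j, j') P)"
proof -
  have "similar_gap (2 ^ k) p q" if "p \<in> P" "q \<in> P" for p q
    using assms(1) that similar_gap_mono[of "2 ^ Suc k" p q "2 ^ k"] by (auto simp: coherent_def)
  then show ?thesis
    using assms similar_gap_refl similar_gap_sym by (auto simp: coherent_def)
qed

text \<open>A j closer than K to a played exponent is answered at the same offset from its partner.
  A j far from all of them is answered K above the partner of the nearest played exponent below; any
  played exponent above j is at least 2K away from that one, and so are their partners, which leaves
  K.\<close>

lemma coherent_extend:
  assumes coh: "coherent (Suc k) m m' P"
  shows "\<exists>j'. coherent k m m' (insert (j, j') P)"
proof -
  define K :: nat where "K = 2 ^ k"
  have K: "1 \<le> K" by (simp add: K_def)
  have gap: "similar_gap (2 * K) (i, i') (l, l')" if "(i, i') \<in> P" "(l, l') \<in> P" for i i' l l'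
    using coherent_gap[OF coh that] by (simp add: K_def)
  have "\<exists>j'. \<forall>p \<in> P. similar_gap K (j, j') p"
  proof (cases "\<exists>(i, i') \<in> P. i < j + K \<and> j < i + K")
    case True
    then obtain i i' where i: "(i, i') \<in> P" "i < j + K" "j < i + K" by blast
    \<comment> \<open>Compare with (0, 0): either i = i', or i' >= 2K while i < j + K. Hence i' + j
      - i is not truncated.\<close>
    have nonneg: "i \<le> i' + j"
      using gap[OF i(1), of 0 0] coh i by (auto simp: similar_gap_def coherent_def)
    have "similar_gap K (j, i' + j - i) (l, l')" if "(l, l') \<in> P" for l l'
      using gap[OF i(1) that] i nonneg unfolding similar_gap_def fst_conv snd_conv by linarith
    then show ?thesis by fast
  next
    case False
    then have far: "j + K \<le> i \<or> i + K \<le> j" if "(i, i') \<in> P" for i i'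
      using that by force
    \<comment> \<open>P may be infinite, but B is bounded by j, and the endpoint (0, 0) makes it
      nonempty, so \<open>Max B\<close> is meaningful.\<close>
    define B where "B = {i. i \<le> j \<and> i \<in> Domain P}"
    have B: "finite B" "0 \<in> B"
      using coh by (auto simp: B_def coherent_def intro: finite_subset[of _ "{..j}"])
    then have "Max B \<in> B" by (intro Max_in) auto
    then obtain i' where i: "(Max B, i') \<in> P" "Max B \<le> j" by (auto simp: B_def)
    have "similar_gap K (j, i' + K) (l, l')" if l: "(l, l') \<in> P" for l l'
    proof (cases "l \<le> j")
      case True
      then have "l \<le> Max B" using l B by (auto simp: B_def intro!: Max_ge)
      then show ?thesis
        using gap[OF i(1) l] far[OF l] far[OF i(1)] i(2) K True
        unfolding similar_gap_def fst_conv snd_conv by linarith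
    next
      case False
      then show ?thesis
        using gap[OF i(1) l] far[OF l] far[OF i(1)] i(2)
        unfolding similar_gap_def fst_conv snd_conv by linarith
    qed
    then show ?thesis by fast
  qed
  then show ?thesis using coherent_insert[OF coh] unfolding K_def by blast
qed

text \<open>Applying a successor function can turn exponent j into j + 1, so all pairs are kept and
  also advanced.\<close>

definition with_next :: "(nat \<times> nat) set \<Rightarrow> (nat \<times> nat) set" where
  "with_next P = {(j + a, j' + a) |j j' a. (j, j') \<in> P \<and> a \<le> 1}"

lemma with_next_Suc: "(j, j') \<in> P \<Longrightarrow> (Suc j, Suc j') \<in> with_next P"
  unfolding with_next_def by (intro CollectI exI[of _ j] exI[of _ j'] exI[of _ 1]) simp

lemma subset_with_next: "P \<subseteq> with_next P"
proof
  fix p assume "p \<in> P"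
  then show "p \<in> with_next P" unfolding with_next_def
    by (intro CollectI exI[of _ "fst p"] exI[of _ "snd p"] exI[of _ 0]) simp
qed

text \<open>Both components of a pair advance together, so equal gaps stay equal, and a gap of 2K
  shrinks by at most 1 <= K.\<close>

lemma coherent_with_next:
  assumes coh: "coherent (Suc k) m m' P"
  shows "coherent k m m' (with_next P)"
proof -
  define K :: nat where "K = 2 ^ k"
  have K: "1 \<le> K" by (simp add: K_def)
  have "similar_gap K p q" if pq: "p \<in> with_next P" "q \<in> with_next P" for p q
  proof -
    obtain i i' a where p: "(i, i') \<in> P" "p = (i + a, i' + a)" "a \<le> 1"
      using pq(1) unfolding with_next_def by blast
    obtain j j' b where q: "(j, j') \<in> P" "q = (j + b, j' + b)" "b \<le> 1"
      using pq(2) unfolding with_next_def by blast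
    have "similar_gap (2 * K) (i, i') (j, j')"
      using coherent_gap[OF coh p(1) q(1)] by (simp add: K_def)
    then consider "int i - int j = int i' - int j'"
      | "i + 2 * K \<le> j" "i' + 2 * K \<le> j'" | "j + 2 * K \<le> i" "j' + 2 * K \<le> i'"
      by (auto simp: similar_gap_def)
    then show ?thesis
      using p(3) q(3) K unfolding p(2) q(2) by cases (auto simp: similar_gap_def)
  qed
  then show ?thesis using coh subset_with_next unfolding coherent_def K_def by blast
qed

section \<open>Trees with a self-embedding onto a cone\<close>

primrec trm_depth :: "trm \<Rightarrow> nat" where
  "trm_depth (Var v) = 0"
| "trm_depth (Succ i t) = Suc (trm_depth t)"

text \<open>Term depth is charged like quantifiers, since each level of function application may
  also halve the threshold.\<close>

primrec fm_rank :: "fm \<Rightarrow> nat" where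
  "fm_rank (Eq s t) = trm_depth s + trm_depth t"
| "fm_rank (Le s t) = trm_depth s + trm_depth t"
| "fm_rank (Neg p) = fm_rank p"
| "fm_rank (Conj p q) = max (fm_rank p) (fm_rank q)"
| "fm_rank (Ex v p) = Suc (fm_rank p)"

text \<open>What the game uses about prefixing, free of ordinals: \<open>W\<close> embeds the tree
  onto the cone above \<open>W root\<close>, and that cone is entered by a successor only from the
  root, with the prefixed letter \<open>h\<close>.\<close>

locale self_embedded_tree =
  fixes M :: "'u fo_structure" and n :: nat and root :: 'u and W :: "'u \<Rightarrow> 'u" and h :: nat
  assumes root_in: "root \<in> univ M"
    and W_in: "s \<in> univ M \<Longrightarrow> W s \<in> univ M"
    and succs_in: "s \<in> univ M \<Longrightarrow> i < n \<Longrightarrow> succs M i s \<in> univ M"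
    and le_refl: "s \<in> univ M \<Longrightarrow> le M s s"
    and le_antisym: "s \<in> univ M \<Longrightarrow> t \<in> univ M \<Longrightarrow> le M s t \<Longrightarrow> le M t s \<Longrightarrow> s = t"
    and root_le: "s \<in> univ M \<Longrightarrow> le M root s"
    and le_W_iff: "s \<in> univ M \<Longrightarrow> t \<in> univ M \<Longrightarrow> le M (W s) (W t) \<longleftrightarrow> le M s t"
    and cone_W: "s \<in> univ M \<Longrightarrow> le M (W root) s \<Longrightarrow> \<exists>t \<in> univ M. s = W t"
    and cone_up: "s \<in> univ M \<Longrightarrow> t \<in> univ M \<Longrightarrow> le M (W s) t \<Longrightarrow> le M (W root) t"
    and below_cone: "s \<in> univ M \<Longrightarrow> t \<in> univ M \<Longrightarrow> le M s (W t) \<Longrightarrow>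
      s = root \<or> le M (W root) s"
    and W_not_le_root: "s \<in> univ M \<Longrightarrow> \<not> le M (W s) root"
    and succs_W: "s \<in> univ M \<Longrightarrow> i < n \<Longrightarrow> succs M i (W s) = W (succs M i s)"
    and succs_root: "succs M h root = W root"
    and cone_succs: "s \<in> univ M \<Longrightarrow> i < n \<Longrightarrow> le M (W root) (succs M i s) \<Longrightarrow>
      le M (W root) s \<or> i = h \<and> s = root"
begin

text \<open>At j = m the remainder is unrestricted. This cap gives a normal form even to words that
  begin with infinitely many 1s.\<close>

definition normal :: "nat \<Rightarrow> nat \<Rightarrow> 'u \<Rightarrow> bool" where
  "normal m j t \<longleftrightarrow> t \<in> univ M \<and> j \<le> m \<and> (j < m \<longrightarrow> \<not> le M (W root) t)"

definition matched :: "nat \<Rightarrow> nat \<Rightarrow> (nat \<times> nat) set \<Rightarrow> 'u \<Rightarrow> 'u \<Rightarrow> bool" where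
  "matched m m' P a a' \<longleftrightarrow> (\<exists>(j, j') \<in> P. \<exists>t. normal m j t \<and> normal m' j' t \<and>
     a = (W ^^ j) t \<and> a' = (W ^^ j') t)"

definition position :: "nat \<Rightarrow> nat \<Rightarrow> nat \<Rightarrow> (nat \<Rightarrow> 'u) \<Rightarrow> (nat \<Rightarrow> 'u) \<Rightarrow> bool" where
  "position m m' k e e' \<longleftrightarrow>
     (\<exists>P. coherent k m m' P \<and> (\<forall>v. matched m m' P (e v) (e' v)))"

section \<open>Normal forms and their order\<close>

lemma funpow_W_in: "t \<in> univ M \<Longrightarrow> (W ^^ j) t \<in> univ M"
  by (induction j) (auto intro: W_in)

lemma succs_funpow_W:
  "t \<in> univ M \<Longrightarrow> i < n \<Longrightarrow> succs M i ((W ^^ j) t) = (W ^^ j) (succs M i t)"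
  by (induction j) (auto simp: succs_W funpow_W_in)

lemma funpow_le_iff:
  assumes "s \<in> univ M" "t \<in> univ M"
  shows "le M ((W ^^ j) s) ((W ^^ j) t) \<longleftrightarrow> le M s t"
  by (induction j) (auto simp: le_W_iff funpow_W_in assms)

text \<open>Strip \<open>W\<close> while the word lies in the cone, at most m times.\<close>

lemma normal_exists: "s \<in> univ M \<Longrightarrow> \<exists>j t. normal m j t \<and> s = (W ^^ j) t"
proof (induction m arbitrary: s)
  case 0
  then show ?case by (auto simp: normal_def intro!: exI[of _ 0])
next
  case (Suc m)
  show ?case
  proof (cases "le M (W root) s")
    case True
    then obtain u where u: "u \<in> univ M" "s = W u" using cone_W Suc.prems by blast
    then obtain j t where "normal m j t" "u = (W ^^ j) t" using Suc.IH by blast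
    then show ?thesis using u by (intro exI[of _ "Suc j"] exI[of _ t]) (auto simp: normal_def)
  next
    case False
    then show ?thesis using Suc.prems by (intro exI[of _ 0] exI[of _ s]) (auto simp: normal_def)
  qed
qed

text \<open>Cancel the common power of \<open>W\<close>. If i < j then i < m, so s is outside the
  cone, and only the root is both outside it and below one of its words. If i > j then t is outside
  the cone, which is upward closed. So exponents matter only through their comparison.\<close>

lemma le_normal_iff:
  assumes s: "normal m i s" and t: "normal m j t"
  shows "le M ((W ^^ i) s) ((W ^^ j) t) \<longleftrightarrow> i = j \<and> le M s t \<or> i < j \<and> s = root"
proof -
  have U: "s \<in> univ M" "t \<in> univ M" using s t by (auto simp: normal_def)
  consider "i = j" | d where "j = i + Suc d" | d where "i = j + Suc d"
    by (metis less_iff_Suc_add nat_neq_iff add_Suc_right)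
  then show ?thesis
  proof cases
    case 1
    then show ?thesis using funpow_le_iff U by simp
  next
    case 2
    have "(W ^^ j) t = (W ^^ i) (W ((W ^^ d) t))" unfolding 2 funpow_add by simp
    then have "le M ((W ^^ i) s) ((W ^^ j) t) \<longleftrightarrow> le M s (W ((W ^^ d) t))"
      using funpow_le_iff U by (simp add: W_in funpow_W_in)
    also have "\<dots> \<longleftrightarrow> s = root"
      using below_cone[of s "(W ^^ d) t"] root_le[of "W ((W ^^ d) t)"] U s t 2
      by (auto simp: normal_def W_in funpow_W_in)
    finally show ?thesis using 2 by simp
  next
    case 3
    have "(W ^^ i) s = (W ^^ j) (W ((W ^^ d) s))" unfolding 3 funpow_add by simp
    then have "le M ((W ^^ i) s) ((W ^^ j) t) \<longleftrightarrow> le M (W ((W ^^ d) s)) t"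
      using funpow_le_iff U by (simp add: W_in funpow_W_in)
    moreover have "\<not> le M (W root) t" using s t 3 by (auto simp: normal_def)
    ultimately show ?thesis using cone_up 3 U funpow_W_in by auto
  qed
qed

section \<open>Matched nodes agree on order, equality and successors\<close>

lemma matched_in:
  "matched m m' P a a' \<Longrightarrow> a \<in> univ M \<and> a' \<in> univ M"
  by (auto simp: matched_def normal_def funpow_W_in)

lemma matched_mono: "matched m m' P a a' \<Longrightarrow> P \<subseteq> Q \<Longrightarrow> matched m m' Q a a'"
  unfolding matched_def by blast

lemma matched_converse: "matched m m' P a a' \<Longrightarrow> matched m' m (P\<inverse>) a' a"
  unfolding matched_def by blast

lemma matched_le_iff:
  assumes coh: "coherent k m m' P" and a: "matched m m' P a a'" and b: "matched m m' P b b'"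
  shows "le M a b \<longleftrightarrow> le M a' b'"
proof -
  obtain i i' s where s: "(i, i') \<in> P" "normal m i s" "normal m' i' s"
    "a = (W ^^ i) s" "a' = (W ^^ i') s"
    using a unfolding matched_def by blast
  obtain j j' t where t: "(j, j') \<in> P" "normal m j t" "normal m' j' t"
    "b = (W ^^ j) t" "b' = (W ^^ j') t"
    using b unfolding matched_def by blast
  show ?thesis
    using le_normal_iff[OF s(2) t(2)] le_normal_iff[OF s(3) t(3)] s(4,5) t(4,5)
      coherent_less_iff[OF coh s(1) t(1)] coherent_eq_iff[OF coh s(1) t(1)] by simp
qed

lemma matched_eq_iff:
  assumes "coherent k m m' P" "matched m m' P a a'" "matched m m' P b b'"
  shows "a = b \<longleftrightarrow> a' = b'"
  using matched_le_iff[OF assms] matched_le_iff[OF assms(1,3,2)] matched_in[OF assms(2)]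
    matched_in[OF assms(3)] le_antisym le_refl by metis

text \<open>As (m, m') is in P, j and j' compare alike with the caps m and m'.\<close>

lemma normal_transfer:
  assumes coh: "coherent k m m' P" and "(j, j') \<in> P" "normal m j t"
  shows "normal m' j' t"
proof -
  have "(m, m') \<in> P" using coh by (simp add: coherent_def)
  then show ?thesis
    using assms(3) coherent_less_iff[OF coh assms(2)] coherent_less_iff[OF coh _ assms(2)]
    unfolding normal_def by (meson not_le)
qed

text \<open>Successors pass through \<open>W ^^ j\<close> and act on the common remainder. Normality
  breaks only when the root steps into the cone below the cap; then both exponents rise by
  one.\<close>

lemma matched_succs:
  assumes coh: "coherent (Suc k) m m' P" and a: "matched m m' P a a'" and i: "i < n"
  shows "matched m m' (with_next P) (succs M i a) (succs M i a')"
proof -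
  obtain j j' t where t: "(j, j') \<in> P" "normal m j t" "normal m' j' t"
    "a = (W ^^ j) t" "a' = (W ^^ j') t"
    using a unfolding matched_def by blast
  have U: "t \<in> univ M" using t by (simp add: normal_def)
  have succs: "succs M i a = (W ^^ j) (succs M i t)" "succs M i a' = (W ^^ j') (succs M i t)"
    using t succs_funpow_W U i by auto
  have coh': "coherent k m m' (with_next P)" using coherent_with_next[OF coh] .
  show ?thesis
  proof (cases "j < m \<and> le M (W root) (succs M i t)")
    case True
    then have "i = h" "t = root" using cone_succs[OF U i] t(2) by (auto simp: normal_def)
    then have eq: "succs M i a = (W ^^ Suc j) root" "succs M i a' = (W ^^ Suc j') root"
      using succs succs_root by (simp_all add: funpow_swap1)
    have mem: "(Suc j, Suc j') \<in> with_next P" using with_next_Suc[OF t(1)] .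
    have "normal m (Suc j) root"
      using True root_in W_not_le_root[OF root_in] by (simp add: normal_def)
    then show ?thesis
      using eq mem normal_transfer[OF coh' mem] unfolding matched_def by blast
  next
    case False
    have mem: "(j, j') \<in> with_next P" using t(1) subset_with_next by blast
    have "normal m j (succs M i t)"
      using False t(2) succs_in[OF U i] by (auto simp: normal_def)
    then show ?thesis
      using succs mem normal_transfer[OF coh' mem] unfolding matched_def by blast
  qed
qed

text \<open>One passage to \<open>with_next\<close> serves all terms of the next depth at once, so
  the price is the depth d.\<close>

lemma position_terms:
  assumes "position m m' (k + d) e e'"
  shows "\<exists>Q. coherent k m m' Q \<and>
    (\<forall>t. trm_in_lang n t \<longrightarrow> trm_depth t \<le> d \<longrightarrow> matched m m' Q (trm_val M e t) (trm_val M e' t))"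
  using assms
proof (induction d arbitrary: k)
  case 0
  then obtain P where P: "coherent k m m' P" "\<And>v. matched m m' P (e v) (e' v)"
    by (auto simp: position_def)
  have "matched m m' P (trm_val M e t) (trm_val M e' t)" if "trm_depth t \<le> 0" for t
    using that P(2) by (cases t) auto
  then show ?case using P(1) by blast
next
  case (Suc d)
  then have "position m m' (Suc k + d) e e'" by simp
  from Suc.IH[OF this] obtain Q where Q: "coherent (Suc k) m m' Q"
    "\<And>t. trm_in_lang n t \<Longrightarrow> trm_depth t \<le> d \<Longrightarrow>
      matched m m' Q (trm_val M e t) (trm_val M e' t)" by blast
  have "matched m m' (with_next Q) (trm_val M e t) (trm_val M e' t)"
    if "trm_in_lang n t" "trm_depth t \<le> Suc d" for t
  proof (cases t)
    case (Var v)
    then show ?thesis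
      using Q(2)[of t] matched_mono[OF _ subset_with_next] by simp
  next
    case (Succ i u)
    then show ?thesis using Q(2)[of u] matched_succs[OF Q(1)] that by auto
  qed
  then show ?case using coherent_with_next[OF Q(1)] by blast
qed

section \<open>Moves of the game and agreement on formulas\<close>

lemma position_sym: "position m m' k e e' \<Longrightarrow> position m' m k e' e"
  unfolding position_def using coherent_converse matched_converse by blast

text \<open>Duplicator answers \<open>(W ^^ j) t\<close> by \<open>(W ^^ j') t\<close>, with j' from
  the game on exponents.\<close>

lemma position_forth:
  assumes pos: "position m m' (Suc k) e e'" and a: "a \<in> univ M"
  shows "\<exists>a' \<in> univ M. position m m' k (e(v := a)) (e'(v := a'))"
proof -
  obtain P where P: "coherent (Suc k) m m' P" "\<And>v. matched m m' P (e v) (e' v)"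
    using pos by (auto simp: position_def)
  obtain j t where t: "normal m j t" "a = (W ^^ j) t" using normal_exists[OF a] by blast
  obtain j' where Q: "coherent k m m' (insert (j, j') P)" using coherent_extend[OF P(1)] by blast
  have "normal m' j' t" using normal_transfer[OF Q _ t(1)] by simp
  then have new: "matched m m' (insert (j, j') P) a ((W ^^ j') t)"
    using t unfolding matched_def by blast
  have "matched m m' (insert (j, j') P) (e u) (e' u)" for u
    using matched_mono[OF P(2)] by blast
  then have "position m m' k (e(v := a)) (e'(v := (W ^^ j') t))"
    using Q new unfolding position_def by (intro exI[of _ "insert (j, j') P"]) simp
  then show ?thesis using matched_in[OF new] by blast
qed

lemma position_sat_iff:
  assumes "fm_in_lang n p" "fm_rank p \<le> k" "position m m' k e e'"
  shows "sat M e p \<longleftrightarrow> sat M e' p"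
  using assms
proof (induction p arbitrary: k e e')
  case (Eq s t)
  then have "position m m' (k - fm_rank (Eq s t) + fm_rank (Eq s t)) e e'" by simp
  from position_terms[OF this] obtain Q where "coherent (k - fm_rank (Eq s t)) m m' Q"
    "matched m m' Q (trm_val M e s) (trm_val M e' s)"
    "matched m m' Q (trm_val M e t) (trm_val M e' t)"
    using Eq.prems(1) by auto
  then show ?case using matched_eq_iff by simp
next
  case (Le s t)
  then have "position m m' (k - fm_rank (Le s t) + fm_rank (Le s t)) e e'" by simp
  from position_terms[OF this] obtain Q where "coherent (k - fm_rank (Le s t)) m m' Q"
    "matched m m' Q (trm_val M e s) (trm_val M e' s)"
    "matched m m' Q (trm_val M e t) (trm_val M e' t)"
    using Le.prems(1) by auto
  then show ?case using matched_le_iff by simp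
next
  case (Neg p)
  then show ?case by (metis fm_in_lang.simps(3) fm_rank.simps(3) sat.simps(3))
next
  case (Conj p q)
  then have "sat M e p = sat M e' p" "sat M e q = sat M e' q" by auto
  then show ?case by simp
next
  case (Ex v p)
  then obtain l where k: "k = Suc l" "fm_rank p \<le> l" by (cases k) auto
  have p: "fm_in_lang n p" using Ex.prems by simp
  show ?case
  proof
    assume "sat M e (Ex v p)"
    then obtain a where a: "a \<in> univ M" "sat M (e(v := a)) p" by auto
    obtain a' where "a' \<in> univ M" "position m m' l (e(v := a)) (e'(v := a'))"
      using position_forth a(1) Ex.prems(3) k by blast
    then show "sat M e' (Ex v p)" using Ex.IH[OF p k(2)] a by auto
  next
    assume "sat M e' (Ex v p)"
    then obtain a' where a': "a' \<in> univ M" "sat M (e'(v := a')) p" by auto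
    \<comment> \<open>The back move is a forth move with the roles of m and m' exchanged; since both
      are fixed in the induction, the roles are exchanged back afterwards.\<close>
    obtain a where "a \<in> univ M" "position m' m l (e'(v := a')) (e(v := a))"
      using position_forth[OF position_sym] a'(1) Ex.prems(3) k by blast
    then show "sat M e (Ex v p)" using Ex.IH[OF p k(2) position_sym] a' by auto
  qed
qed

text \<open>Both m and m + 1 are at distance at least 2^k from 0. Outside the cone, x has exponent 0
  and is matched with itself.\<close>

lemma position_initial:
  assumes "2 ^ k \<le> m" "x \<in> univ M" "\<not> le M (W root) x"
  shows "position m (Suc m) k (\<lambda>v. if v = 0 then x else (W ^^ m) root)
    (\<lambda>v. if v = 0 then x else (W ^^ Suc m) root)"
proof -
  let ?P = "{(0, 0), (m, Suc m)}"
  have "coherent k m (Suc m) ?P" using assms(1) by (auto simp: coherent_def similar_gap_def)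
  moreover have "matched m (Suc m) ?P x x"
    unfolding matched_def using assms(2,3) by (auto simp: normal_def)
  moreover have "matched m (Suc m) ?P ((W ^^ m) root) ((W ^^ Suc m) root)"
    unfolding matched_def using root_in by (auto simp: normal_def)
  ultimately show ?thesis unfolding position_def by (intro exI[of _ ?P]) auto
qed

lemma not_separating:
  assumes "fm_in_lang n p" "x \<in> univ M" "\<not> le M (W root) x" "2 ^ fm_rank p \<le> m"
  shows "sat M (\<lambda>v. if v = 0 then x else (W ^^ m) root) p \<longleftrightarrow>
    sat M (\<lambda>v. if v = 0 then x else (W ^^ Suc m) root) p"
  using position_sat_iff[OF assms(1) order_refl position_initial[OF assms(4,2,3)]] .

end

section \<open>Prefixing a letter to transfinite words\<close>

locale word_tree =
  fixes n :: nat and r :: "'a rel"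
  assumes two_le: "2 \<le> n" and lim: "limit_ord r"
begin

lemma wo: "Well_order r"
  using lim by (simp add: limit_ord_def)

sublocale wo_rel r
  using wo by (simp add: wo_rel_def)

lemma dom_node:
  assumes "s \<in> nodes n r"
  shows "ht r s \<in> Field r" "dom s = underS (ht r s)"
proof -
  obtain b where b: "b \<in> Field r" "dom s = underS b" using assms by (auto simp: nodes_def)
  show "ht r s \<in> Field r" "dom s = underS (ht r s)" using ht_eqI[OF wo b] b by simp_all
qed

lemma nodeI: "b \<in> Field r \<Longrightarrow> dom s = underS b \<Longrightarrow> ran s \<subseteq> {..<n} \<Longrightarrow> s \<in> nodes n r"
  by (auto simp: nodes_def)

lemma ran_node: "s \<in> nodes n r \<Longrightarrow> ran s \<subseteq> {..<n}"
  by (auto simp: nodes_def)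

lemma empty_node: "Map.empty \<in> nodes n r"
proof -
  have ne: "Field r \<noteq> {}" using lim by (simp add: limit_ord_def)
  then have m: "minim (Field r) \<in> Field r" using minim_in by simp
  have "underS (minim (Field r)) = {}"
    using minim_least[of "Field r"] m ANTISYM
    by (auto simp: underS_def antisym_def dest: FieldI1)
  then show ?thesis using nodeI[OF m, of Map.empty] by simp
qed

section \<open>The finite ordinals and the left shift of positions\<close>

lemma dom_extend: "dom (extend r i s) = insert (ht r s) (dom s)"
  by (auto simp: extend_def)

text \<open>The finite ordinal i is taken as the height of the word of i zeros, so
  \<open>extend_in_nodes\<close> supplies the successors.\<close>

definition fin_ord :: "nat \<Rightarrow> 'a" where
  "fin_ord i = ht r ((extend r 0 ^^ i) Map.empty)"

lemma zeros_node: "(extend r 0 ^^ i) Map.empty \<in> nodes n r"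
  using empty_node two_le by (induction i) (auto intro: extend_in_nodes[OF lim])

lemma fin_ord_in: "fin_ord i \<in> Field r"
  using dom_node(1)[OF zeros_node] by (simp add: fin_ord_def)

lemma underS_fin_ord: "underS (fin_ord i) = fin_ord ` {..<i}"
proof (induction i)
  case 0
  then show ?case using dom_node(2)[OF empty_node] by (simp add: fin_ord_def)
next
  case (Suc i)
  have "underS (fin_ord (Suc i)) = dom ((extend r 0 ^^ Suc i) Map.empty)"
    using dom_node(2)[OF zeros_node[of "Suc i"]] by (simp add: fin_ord_def)
  also have "\<dots> = insert (fin_ord i) (underS (fin_ord i))"
    using dom_node(2)[OF zeros_node[of i]] by (simp add: dom_extend fin_ord_def)
  finally show ?case using Suc by (simp add: lessThan_Suc)
qed

lemma fin_ord_less: "i < j \<Longrightarrow> fin_ord i \<in> underS (fin_ord j)"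
  by (simp add: underS_fin_ord)

lemma inj_fin_ord: "inj fin_ord"
proof (rule injI)
  fix i j assume "fin_ord i = fin_ord j"
  then show "i = j" using fin_ord_less[of i j] fin_ord_less[of j i]
    by (cases i j rule: linorder_cases) (auto simp: underS_def)
qed

lemma fin_ord_eq_iff [simp]: "fin_ord i = fin_ord j \<longleftrightarrow> i = j"
  using inj_fin_ord by (auto dest: injD)

lemma fin_ord_below:
  assumes "b \<in> Field r" "b \<notin> range fin_ord"
  shows "fin_ord i \<in> underS b"
proof (rule ccontr)
  assume "fin_ord i \<notin> underS b"
  then have "b = fin_ord i \<or> b \<in> underS (fin_ord i)"
    using TOTALS assms(1) fin_ord_in[of i] by (auto simp: underS_def)
  then show False using assms(2) underS_fin_ord by blast
qed

text \<open>The map \<open>\<beta> \<mapsto> 1 + \<beta>\<close>.\<close>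

definition shift :: "'a \<Rightarrow> 'a" where
  "shift x = (if x \<in> range fin_ord then fin_ord (Suc (inv fin_ord x)) else x)"

lemma shift_fin_ord [simp]: "shift (fin_ord i) = fin_ord (Suc i)"
  by (simp add: shift_def inv_f_f[OF inj_fin_ord])

lemma shift_other [simp]: "x \<notin> range fin_ord \<Longrightarrow> shift x = x"
  by (simp add: shift_def)

lemma shift_neq_zero [simp]: "shift x \<noteq> fin_ord 0"
  by (cases "x \<in> range fin_ord") auto

lemma zero_neq_shift [simp]: "fin_ord 0 \<noteq> shift x"
  using shift_neq_zero by metis

lemma shift_eq_iff [simp]: "shift x = shift y \<longleftrightarrow> x = y"
  by (cases "x \<in> range fin_ord"; cases "y \<in> range fin_ord") (auto simp: image_iff)

text \<open>The map \<open>shift\<close> fixes everything but the finite ordinals, even outside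
  \<open>Field r\<close>. So this split covers the whole type, and maps can be compared
  pointwise.\<close>

lemma zero_or_shift: obtains "x = fin_ord 0" | y where "x = shift y"
proof (cases "x \<in> range fin_ord")
  case True
  then obtain i where "x = fin_ord i" by blast
  then show ?thesis using that shift_fin_ord by (cases i) metis+
next
  case False
  then show ?thesis using that(2)[of x] by simp
qed

lemma shift_in_Field_iff: "shift x \<in> Field r \<longleftrightarrow> x \<in> Field r"
  by (cases "x \<in> range fin_ord") (auto simp: fin_ord_in)

text \<open>For infinite b all finite ordinals lie below b; hence \<open>shift\<close> preserves
  membership in \<open>underS b\<close> both ways and misses only 0.\<close>

lemma underS_shift:
  assumes "b \<in> Field r"
  shows "underS (shift b) = insert (fin_ord 0) (shift ` underS b)"
proof (cases "b \<in> range fin_ord")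
  case True
  then obtain i where "b = fin_ord i" by blast
  then show ?thesis
    by (simp add: underS_fin_ord lessThan_Suc_eq_insert_0 image_image)
next
  case False
  have "x \<in> underS b \<longleftrightarrow> shift x \<in> underS b" for x
    using fin_ord_below[OF assms False] by (cases "x \<in> range fin_ord") auto
  then have "x \<in> underS b \<longleftrightarrow> x \<in> insert (fin_ord 0) (shift ` underS b)" for x
    using fin_ord_below[OF assms False] by (cases x rule: zero_or_shift) auto
  then have "underS b = insert (fin_ord 0) (shift ` underS b)" by blast
  then show ?thesis using False by simp
qed

section \<open>Prefixing the letter 1 to words\<close>

definition prefix1 :: "('a \<rightharpoonup> nat) \<Rightarrow> ('a \<rightharpoonup> nat)" where
  "prefix1 s x = (if x = fin_ord 0 then Some 1 else s (inv shift x))"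

lemma prefix1_zero [simp]: "prefix1 s (fin_ord 0) = Some 1"
  by (simp add: prefix1_def)

lemma prefix1_shift [simp]: "prefix1 s (shift x) = s x"
  by (simp add: prefix1_def inv_f_f inj_def)

lemma eq_prefix1I:
  assumes "t (fin_ord 0) = Some 1" "\<And>x. t (shift x) = s x"
  shows "t = prefix1 s"
proof
  show "t x = prefix1 s x" for x using assms by (cases x rule: zero_or_shift) auto
qed

lemma dom_prefix1: "dom (prefix1 s) = insert (fin_ord 0) (shift ` dom s)"
proof -
  have "x \<in> dom (prefix1 s) \<longleftrightarrow> x \<in> insert (fin_ord 0) (shift ` dom s)" for x
    by (cases x rule: zero_or_shift) auto
  then show ?thesis by blast
qed

lemma ran_prefix1: "ran (prefix1 s) \<subseteq> insert 1 (ran s)"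
proof
  fix v assume "v \<in> ran (prefix1 s)"
  then obtain x where "prefix1 s x = Some v" by (auto simp: ran_def)
  then show "v \<in> insert 1 (ran s)" by (cases x rule: zero_or_shift) (auto simp: ran_def)
qed

lemma dom_prefix1_node:
  assumes "s \<in> nodes n r"
  shows "dom (prefix1 s) = underS (shift (ht r s))"
  using dom_node[OF assms] by (simp add: dom_prefix1 underS_shift)

lemma prefix1_node:
  assumes "s \<in> nodes n r"
  shows "prefix1 s \<in> nodes n r"
proof (rule nodeI)
  show "dom (prefix1 s) = underS (shift (ht r s))" using dom_prefix1_node[OF assms] .
  show "shift (ht r s) \<in> Field r" using dom_node(1)[OF assms] by (simp add: shift_in_Field_iff)
  show "ran (prefix1 s) \<subseteq> {..<n}" using ran_prefix1[of s] ran_node[OF assms] two_le by auto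
qed

lemma ht_prefix1:
  assumes "s \<in> nodes n r"
  shows "ht r (prefix1 s) = shift (ht r s)"
  using ht_eqI[OF wo _ dom_prefix1_node[OF assms]] dom_node(1)[OF assms]
  by (simp add: shift_in_Field_iff)

lemma extend_prefix1:
  assumes "s \<in> nodes n r"
  shows "extend r i (prefix1 s) = prefix1 (extend r i s)"
  by (intro eq_prefix1I) (auto simp: extend_def ht_prefix1[OF assms])

text \<open>Composing with \<open>shift\<close> deletes the first letter. The new height b solves 1
  + b = \<open>ht r s\<close>, which is possible because \<open>ht r s\<close> is not 0.\<close>

lemma unprefix_node:
  assumes s: "s \<in> nodes n r" and one: "s (fin_ord 0) = Some 1"
  shows "s \<circ> shift \<in> nodes n r" "s = prefix1 (s \<circ> shift)"
proof -
  show "s = prefix1 (s \<circ> shift)" using one by (intro eq_prefix1I) auto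
  have "fin_ord 0 \<in> underS (ht r s)" using one dom_node(2)[OF s] by auto
  then have "ht r s \<noteq> fin_ord 0" by (auto simp: underS_def)
  then obtain b where b: "ht r s = shift b" using zero_or_shift by metis
  then have F: "b \<in> Field r" using dom_node(1)[OF s] by (simp add: shift_in_Field_iff)
  have "dom (s \<circ> shift) = shift -` dom s" by auto
  also have "\<dots> = underS b" using dom_node(2)[OF s] b underS_shift[OF F] by auto
  finally have "dom (s \<circ> shift) = underS b" .
  moreover have "ran (s \<circ> shift) \<subseteq> {..<n}" using ran_node[OF s] by (auto simp: ran_def)
  ultimately show "s \<circ> shift \<in> nodes n r" using F nodeI by blast
qed

lemma prefix1_le_iff: "prefix1 s \<subseteq>\<^sub>m prefix1 t \<longleftrightarrow> s \<subseteq>\<^sub>m t"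
  by (auto simp: map_le_def dom_prefix1)

lemma prefix1_empty: "prefix1 Map.empty = [fin_ord 0 \<mapsto> 1]"
  by (intro eq_prefix1I[symmetric]) auto

lemma prefix1_empty_le_iff: "prefix1 Map.empty \<subseteq>\<^sub>m s \<longleftrightarrow> s (fin_ord 0) = Some 1"
  by (auto simp: prefix1_empty map_le_def)

lemma ht_eq_zero: "s \<in> nodes n r \<Longrightarrow> ht r s = fin_ord 0 \<Longrightarrow> s = Map.empty"
  using dom_node(2)[of s] underS_fin_ord[of 0] by simp

lemma zero_in_dom:
  assumes "s \<in> nodes n r" "s \<noteq> Map.empty"
  shows "fin_ord 0 \<in> dom s"
proof -
  have "ht r s \<noteq> fin_ord 0" using ht_eq_zero assms by blast
  then obtain b where b: "ht r s = shift b" using zero_or_shift by metis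
  then have "b \<in> Field r" using dom_node(1)[OF assms(1)] by (simp add: shift_in_Field_iff)
  then show ?thesis using dom_node(2)[OF assms(1)] b underS_shift by auto
qed

text \<open>Here \<open>W root\<close> is the one-letter word 1, so lying in the cone means having
  first letter 1.\<close>

sublocale self_embedded_tree "tree n r" n Map.empty prefix1 1
proof (unfold_locales, unfold tree_def fo_structure.simps prefix1_empty_le_iff)
  fix s t :: "'a \<rightharpoonup> nat" and i
  show "Map.empty \<in> nodes n r" by (rule empty_node)
  show "prefix1 s \<in> nodes n r" if "s \<in> nodes n r" using prefix1_node that .
  show "extend r i s \<in> nodes n r" if "s \<in> nodes n r" "i < n" using extend_in_nodes lim that .
  show "s \<subseteq>\<^sub>m s" by simp
  show "s = t" if "s \<subseteq>\<^sub>m t" "t \<subseteq>\<^sub>m s" using map_le_antisym that .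
  show "Map.empty \<subseteq>\<^sub>m s" by simp
  show "prefix1 s \<subseteq>\<^sub>m prefix1 t \<longleftrightarrow> s \<subseteq>\<^sub>m t" by (rule prefix1_le_iff)
  show "\<exists>t\<in>nodes n r. s = prefix1 t" if "s \<in> nodes n r" "s (fin_ord 0) = Some 1"
    using unprefix_node[OF that] by blast
  show "t (fin_ord 0) = Some 1" if "prefix1 s \<subseteq>\<^sub>m t"
    using that by (auto simp: map_le_def dom_prefix1)
  show "s = Map.empty \<or> s (fin_ord 0) = Some 1" if "s \<in> nodes n r" "s \<subseteq>\<^sub>m prefix1 t"
    using zero_in_dom[OF that(1)] that(2) by (metis map_le_def prefix1_zero)
  show "\<not> prefix1 s \<subseteq>\<^sub>m Map.empty" by (auto simp: map_le_def dom_prefix1)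
  show "extend r i (prefix1 s) = prefix1 (extend r i s)" if "s \<in> nodes n r"
    using extend_prefix1 that .
  show "extend r 1 Map.empty = prefix1 Map.empty"
    by (simp add: extend_def prefix1_empty fin_ord_def)
  \<comment> \<open>Appending a letter changes the entry at position 0 only if the word was
    empty.\<close>
  show "s (fin_ord 0) = Some 1 \<or> i = 1 \<and> s = Map.empty"
    if "s \<in> nodes n r" "extend r i s (fin_ord 0) = Some 1"
    using that ht_eq_zero by (auto simp: extend_def split: if_splits)
qed

section \<open>The words of m zeros and of m ones\<close>

lemma ones_node: "(prefix1 ^^ m) Map.empty \<in> nodes n r"
  using funpow_W_in[OF root_in] by (simp add: tree_def)

text \<open>Prefixing a 1 to a block of ones is the same as appending it, and the domain after
  \<open>extend\<close> depends only on the domain before.\<close>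

lemma dom_zeros_eq_dom_ones:
  "dom ((extend r 0 ^^ m) Map.empty) = dom ((prefix1 ^^ m) Map.empty)"
proof (induction m)
  case (Suc m)
  have "(prefix1 ^^ Suc m) Map.empty = extend r 1 ((prefix1 ^^ m) Map.empty)"
    using succs_funpow_W[OF root_in, of 1 m] succs_root two_le
    by (simp add: tree_def funpow_swap1)
  then show ?case using Suc by (simp add: dom_extend) (simp only: ht_def Suc)
qed simp

lemma ht_ones: "ht r ((prefix1 ^^ m) Map.empty) = fin_ord m"
  using dom_zeros_eq_dom_ones[of m] unfolding ht_def fin_ord_def by metis

lemma zeros_not_in_cone: "((extend r 0 ^^ m) Map.empty) (fin_ord 0) \<noteq> Some 1"
  by (induction m) (auto simp: extend_def)

lemma equal_height_not_definable: "\<not> definable2 n (tree n r) (\<lambda>x y. ht r x = ht r y)"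
proof
  assume "definable2 n (tree n r) (\<lambda>x y. ht r x = ht r y)"
  then obtain p where p: "fm_in_lang n p"
    "\<And>x y. x \<in> nodes n r \<Longrightarrow> y \<in> nodes n r \<Longrightarrow>
      sat (tree n r) (\<lambda>v. if v = 0 then x else y) p \<longleftrightarrow> ht r x = ht r y"
    by (auto simp: definable2_def tree_def)
  \<comment> \<open>The least m for which both starting gaps reach the threshold for the rank of
    p.\<close>
  define m :: nat where "m = 2 ^ fm_rank p"
  let ?x = "(extend r 0 ^^ m) Map.empty"
  have "\<not> le (tree n r) (prefix1 Map.empty) ?x"
    using zeros_not_in_cone prefix1_empty_le_iff by (simp add: tree_def)
  then have "ht r ?x = ht r ((prefix1 ^^ m) Map.empty) \<longleftrightarrow>
      ht r ?x = ht r ((prefix1 ^^ Suc m) Map.empty)"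
    using not_separating[OF p(1), of ?x m] p(2)[OF zeros_node ones_node] zeros_node
    by (simp add: tree_def m_def del: funpow.simps)
  then show False by (simp only: ht_ones fin_ord_def[symmetric] fin_ord_eq_iff) simp
qed

end

theorem theorem26:
  fixes r :: "'a rel" and n :: nat
  assumes "n \<ge> 2"
    and "limit_ord r"
    and "natLeq \<le>o r"
  shows "\<not> definable2 n (tree n r) (\<lambda>x y. ht r x = ht r y)"
proof -
  interpret word_tree n r using assms(1,2) by unfold_locales
  show ?thesis by (rule equal_height_not_definable)
qed

end
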